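(* Let $k$ be a nonnegative integer, let $H$ be a self $k$-resolved graph of order $n_2$ and let $G$ be a connected graph of diameter $D(G)<k$. Then $\dim(G\boxtimes H)\le n_2\cdot \dim(G)$.
   Context: All graphs are simple and connected; $d_G(x,y)$ is the shortest-path distance. A set $S\subseteq V(G)$ is a metric generator for $G$ if for every two distinct vertices $x,y$ there is $s\in S$ with $d_G(s,x)\ne d_G(s,y)$; $\dim(G)$ is the minimum cardinality of a metric generator. The strong product $G\boxtimes H$ has vertex set $V(G)\times V(H)$, with $(a,b)$ and $(c,d)$ adjacent iff ($a=c$ and $bd\in E(H)$) or ($b=d$ and $ac\in E(G)$) or ($ac\in E(G)$ and $bd\in E(H)$). The interval $I[x,y]$ is the set of vertices lying on some shortest $x$–$y$ path. For a nonnegative integer $k$, a connected graph $H$ is self $k$-resolved if for every two distinct vertices $x,y$ of $H$ there is a vertex $w$ such that either $d_H(y,w)\ge k$ and $x\in I[y,w]$, or $d_H(x,w)\ge k$ and $y\in I[x,w]$.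
   Formalization: The case where G has one vertex and H has at least two is excluded: there dim(G)=0 (the empty set is a metric generator) while dim(G⊠H)=dim(H)≥1, so the inequality always fails (e.g. k=1, G=K_1, H=K_2). *)

theory Defs
  imports "Graph_Theory.Graph_Theory"
begin

text \<open>
  A finite simple graph is a \<^locale>\<open>pair_graph\<close>: every undirected edge is represented
  by its two opposite arcs. Its distance is the library's shortest-path distance
  for unit arc weights; being an infimum over walks, it is an extended real.
\<close>

definition gdist :: "'a pair_pre_digraph \<Rightarrow> 'a \<Rightarrow> 'a \<Rightarrow> ereal" where
  "gdist G x y = wf_digraph.\<mu> (with_proj G) (\<lambda>_. 1) x y"

definition gdiameter :: "'a pair_pre_digraph \<Rightarrow> ereal" where
  "gdiameter G = (SUP x\<in>pverts G. SUP y\<in>pverts G. gdist G x y)"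

definition shortest_path :: "'a pair_pre_digraph \<Rightarrow> 'a \<Rightarrow> ('a \<times> 'a) awalk \<Rightarrow> 'a \<Rightarrow> bool" where
  "shortest_path G x p y \<longleftrightarrow>
     pre_digraph.apath (with_proj G) x p y \<and> ereal (real (length p)) = gdist G x y"

definition geodesic_interval :: "'a pair_pre_digraph \<Rightarrow> 'a \<Rightarrow> 'a \<Rightarrow> 'a set" where
  "geodesic_interval G x y =
     {z. \<exists>p. shortest_path G x p y \<and> z \<in> set (pre_digraph.awalk_verts (with_proj G) x p)}"

definition metric_generator :: "'a pair_pre_digraph \<Rightarrow> 'a set \<Rightarrow> bool" where
  "metric_generator G S \<longleftrightarrow> S \<subseteq> pverts G \<and>
     (\<forall>x\<in>pverts G. \<forall>y\<in>pverts G. x \<noteq> y \<longrightarrow> (\<exists>s\<in>S. gdist G s x \<noteq> gdist G s y))"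

text \<open>
  For a one-vertex graph the empty set is a metric generator, so its metric dimension is 0.
\<close>

definition metric_dim :: "'a pair_pre_digraph \<Rightarrow> nat" where
  "metric_dim G = (LEAST n. \<exists>S. metric_generator G S \<and> card S = n)"

definition strong_product ::
  "'a pair_pre_digraph \<Rightarrow> 'b pair_pre_digraph \<Rightarrow> ('a \<times> 'b) pair_pre_digraph" where
  "strong_product G H =
     \<lparr> pverts = pverts G \<times> pverts H,
       parcs = {((a, b), (c, d)) | a b c d.
                  (a \<in> pverts G \<and> a = c \<and> (b, d) \<in> parcs H) \<or>
                  (b \<in> pverts H \<and> b = d \<and> (a, c) \<in> parcs G) \<or>
                  ((a, c) \<in> parcs G \<and> (b, d) \<in> parcs H)} \<rparr>"

definition self_resolved :: "nat \<Rightarrow> 'a pair_pre_digraph \<Rightarrow> bool" where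
  "self_resolved k H \<longleftrightarrow>
     pair_graph H \<and> Digraph_Component.connected (with_proj H) \<and>
     (\<forall>x\<in>pverts H. \<forall>y\<in>pverts H. x \<noteq> y \<longrightarrow>
        (\<exists>w\<in>pverts H.
           (gdist H y w \<ge> ereal (real k) \<and> x \<in> geodesic_interval H y w) \<or>
           (gdist H x w \<ge> ereal (real k) \<and> y \<in> geodesic_interval H x w)))"

end

theory Submission
  imports Defs
begin

text \<open>
  Distances in the strong product are maxima of the distances in the factors, because a ball of
  radius n is an n-fold power of the reflexive closure of the arc relation and the reflexive
  closure of the product relation is the product of the reflexive closures. Let S be a metric
  basis of G. Then S \<open>\<times>\<close> V(H) resolves two vertices with equal second coordinate b inside the
  layer over b. Vertices (a, b), (c, d) with b \<open>\<noteq>\<close> d are resolved by any (s, w) where w has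
  distance at least k from d and a geodesic from d to w passes through b (or vice versa): since the
  diameter of G is below k, the larger of the two distances is attained in H alone.
\<close>

section \<open>Balls as powers of the reflexive arc relation\<close>

lemma awalk_le_iff_relpow:
  assumes "pair_wf_digraph G" "x \<in> pverts G"
  shows "(\<exists>p. pre_digraph.awalk (with_proj G) x p y \<and> length p \<le> n)
    \<longleftrightarrow> (x, y) \<in> ((parcs G)\<^sup>=) ^^ n"
proof -
  interpret pair_wf_digraph G by fact
  show ?thesis
    using assms(2)
  proof (induction n arbitrary: x)
    case 0
    then show ?case by (auto simp: awalk_Nil_iff)
  next
    case (Suc n)
    \<comment> \<open>\<open>relpow\<close> unfolds at its last factor, but walks grow at the front;
      the commuted form fits an induction that varies the start vertex.\<close>
    have rel: "((parcs G)\<^sup>=) ^^ Suc n = (parcs G)\<^sup>= O ((parcs G)\<^sup>=) ^^ n"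
      by (simp add: relpow_commute)
    show ?case
    proof
      assume "\<exists>p. awalk x p y \<and> length p \<le> Suc n"
      then obtain p where p: "awalk x p y" "length p \<le> Suc n" by blast
      show "(x, y) \<in> ((parcs G)\<^sup>=) ^^ Suc n"
      proof (cases p)
        case Nil
        then have "awalk x [] y \<and> length ([] :: ('a \<times> 'a) awalk) \<le> n" using p by simp
        then have "(x, y) \<in> ((parcs G)\<^sup>=) ^^ n" using Suc by blast
        \<comment> \<open>Short walks are padded by the reflexive pair \<open>(x, x)\<close>; this
          is why the power captures length at most \<open>n\<close> and not only exactly
          \<open>n\<close>.\<close>
        then show ?thesis unfolding rel by blast
      next
        case (Cons e q)
        with p have e: "e \<in> parcs G" "fst e = x" "awalk (snd e) q y" "length q \<le> n"
          by (auto simp: awalk_Cons_iff)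
        then have "(snd e, y) \<in> ((parcs G)\<^sup>=) ^^ n"
          using Suc.IH[of "snd e"] arc_snd_in_verts by blast
        moreover have "(x, snd e) \<in> parcs G" using e by (metis prod.collapse)
        ultimately show ?thesis unfolding rel by blast
      qed
    next
      assume "(x, y) \<in> ((parcs G)\<^sup>=) ^^ Suc n"
      then obtain z where z: "(x, z) \<in> (parcs G)\<^sup>=" "(z, y) \<in> ((parcs G)\<^sup>=) ^^ n"
        unfolding rel by blast
      then have "z \<in> pverts G" using Suc.prems in_arcsD2 by blast
      then obtain p where p: "awalk z p y" "length p \<le> n" using Suc.IH z by blast
      show "\<exists>p. awalk x p y \<and> length p \<le> Suc n"
      proof (cases "x = z")
        case True
        then show ?thesis using p le_SucI by blast
      next
        case False
        then have "awalk x ((x, z) # p) y \<and> length ((x, z) # p) \<le> Suc n"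
          using z p by (auto simp: awalk_Cons_iff)
        then show ?thesis by blast
      qed
    qed
  qed
qed

lemma gdist_conv_length:
  assumes "pair_wf_digraph G"
  shows "gdist G x y = (INF p\<in>{p. pre_digraph.awalk (with_proj G) x p y}. ereal (real (length p)))"
proof -
  interpret pair_wf_digraph G by fact
  have "awalk_cost (\<lambda>_. 1) p = real (length p)" for p :: "('a \<times> 'a) awalk"
    by (induction p) auto
  then show ?thesis by (simp add: gdist_def \<mu>_def)
qed

text \<open>Lengths are natural numbers, so their infimum over a nonempty set of walks is a
  minimum.\<close>

lemma gdist_attained:
  assumes "pair_wf_digraph G" "pre_digraph.awalk (with_proj G) x p y"
  shows "\<exists>q. pre_digraph.awalk (with_proj G) x q y \<and> gdist G x y = ereal (real (length q))"
proof -
  interpret pair_wf_digraph G by fact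
  obtain q where q: "awalk x q y" "\<And>r. awalk x r y \<Longrightarrow> length q \<le> length r"
    using ex_has_least_nat[of "\<lambda>p. awalk x p y" p length] assms(2) by blast
  have "gdist G x y = ereal (real (length q))"
    unfolding gdist_conv_length[OF assms(1)]
    by (rule antisym) (auto intro!: INF_lower2[of q] INF_greatest q)
  with q show ?thesis by blast
qed

lemma gdist_nat_or_infinity:
  assumes "pair_wf_digraph G"
  shows "gdist G x y = \<infinity> \<or> (\<exists>n::nat. gdist G x y = ereal (real n))"
proof (cases "\<exists>p. pre_digraph.awalk (with_proj G) x p y")
  case True
  then show ?thesis using gdist_attained[OF assms] by blast
next
  case False
  then show ?thesis by (simp add: gdist_conv_length[OF assms] top_ereal_def)
qed

lemma gdist_le_iff_relpow:
  assumes "pair_wf_digraph G" "x \<in> pverts G"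
  shows "gdist G x y \<le> ereal (real n) \<longleftrightarrow> (x, y) \<in> ((parcs G)\<^sup>=) ^^ n"
proof -
  have "gdist G x y \<le> ereal (real n)
    \<longleftrightarrow> (\<exists>p. pre_digraph.awalk (with_proj G) x p y \<and> length p \<le> n)"
  proof (cases "\<exists>p. pre_digraph.awalk (with_proj G) x p y")
    case True
    then obtain q where q: "pre_digraph.awalk (with_proj G) x q y"
        "gdist G x y = ereal (real (length q))"
      using gdist_attained[OF assms(1)] by blast
    have "gdist G x y \<le> ereal (real (length p))" if "pre_digraph.awalk (with_proj G) x p y" for p
      unfolding gdist_conv_length[OF assms(1)] using that by (auto intro: INF_lower2[of p])
    then have "length q \<le> length p" if "pre_digraph.awalk (with_proj G) x p y" for p
      using that q(2) by fastforce
    then show ?thesis using q by (auto intro: order_trans)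
  next
    case False
    then show ?thesis by (auto simp: gdist_conv_length[OF assms(1)] top_ereal_def)
  qed
  then show ?thesis using awalk_le_iff_relpow[OF assms] by blast
qed

text \<open>A value in this discrete range is determined by its natural upper bounds, infinity being
  the one that has none. Equality of distances thus reduces to equality of balls.\<close>

lemma ereal_nat_eqI:
  fixes a b :: ereal
  assumes "a = \<infinity> \<or> (\<exists>n::nat. a = ereal (real n))" "b = \<infinity> \<or> (\<exists>n::nat. b = ereal (real n))"
    and "\<And>n::nat. a \<le> ereal (real n) \<longleftrightarrow> b \<le> ereal (real n)"
  shows "a = b"
  using assms by (metis antisym order_refl ereal_infty_less_eq(1))

section \<open>Metric properties of the distance\<close>

lemma gdist_eq_0_iff:
  assumes "pair_wf_digraph G" "x \<in> pverts G"
  shows "gdist G x y = 0 \<longleftrightarrow> x = y"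
proof -
  have "0 \<le> gdist G x y"
    using gdist_nat_or_infinity[OF assms(1), of x y] by auto
  then have "gdist G x y = 0 \<longleftrightarrow> gdist G x y \<le> ereal (real 0)"
    by (auto simp: zero_ereal_def[symmetric])
  also have "\<dots> \<longleftrightarrow> x = y"
    by (subst gdist_le_iff_relpow[OF assms]) simp
  finally show ?thesis .
qed

lemma gdist_commute:
  assumes "pair_sym_digraph G"
  shows "gdist G x y = gdist G y x"
proof -
  interpret pair_sym_digraph G by fact
  have wf: "pair_wf_digraph G" by unfold_locales
  have len: "length (rev_path p) = length p" for p :: "('a \<times> 'a) awalk"
    by (induction p) auto
  \<comment> \<open>Reversing a walk keeps its length; exchanging \<open>u\<close> and
    \<open>v\<close> then gives the other inequality.\<close>
  have "gdist G u v \<le> gdist G v u" for u v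
    unfolding gdist_conv_length[OF wf]
    by (rule INF_greatest) (auto intro: INF_lower2[of "rev_path _"] simp: len)
  then show ?thesis by (simp add: antisym)
qed

text \<open>Cut a geodesic from \<open>y\<close> to \<open>w\<close> at \<open>x\<close>: the first
  piece is nonempty, so the remaining piece is strictly shorter than the finite distance from
  \<open>y\<close> to \<open>w\<close>.\<close>

lemma gdist_less_if_in_interval:
  assumes "pair_wf_digraph G" "x \<in> geodesic_interval G y w" "x \<noteq> y"
  shows "gdist G x w < gdist G y w"
proof -
  interpret pair_wf_digraph G by fact
  obtain p where p: "shortest_path G y p w" "x \<in> set (awalk_verts y p)"
    using assms(2) by (auto simp: geodesic_interval_def)
  then have walk: "awalk y p w" and len: "gdist G y w = ereal (real (length p))"
    by (auto simp: shortest_path_def apath_def)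
  obtain q r where qr: "p = q @ r" "awalk y q x" "awalk x r w"
    using awalk_decomp[OF walk p(2)] by blast
  then have "q \<noteq> []" using assms(3) by (auto simp: awalk_Nil_iff)
  then have "length r < length p" using qr by simp
  moreover have "gdist G x w \<le> ereal (real (length r))"
    unfolding gdist_conv_length[OF assms(1)] using qr by (auto intro: INF_lower2[of r])
  ultimately show ?thesis using len by (metis ereal_less_eq(3) linorder_not_le of_nat_less_iff order.trans)
qed

section \<open>Distances in the strong product\<close>

lemma pair_wf_digraph_strong_product:
  assumes "pair_wf_digraph G" "pair_wf_digraph H"
  shows "pair_wf_digraph (strong_product G H)"
proof -
  interpret G: pair_wf_digraph G by fact
  interpret H: pair_wf_digraph H by fact
  show ?thesis
    by unfold_locales
      (auto simp: strong_product_def dest: G.in_arcsD1 G.in_arcsD2 H.in_arcsD1 H.in_arcsD2)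
qed

lemma relpow_strong_product:
  assumes "pair_wf_digraph G" "pair_wf_digraph H" "a \<in> pverts G" "b \<in> pverts H"
  shows "((a, b), (c, d)) \<in> ((parcs (strong_product G H))\<^sup>=) ^^ n
    \<longleftrightarrow> (a, c) \<in> ((parcs G)\<^sup>=) ^^ n \<and> (b, d) \<in> ((parcs H)\<^sup>=) ^^ n"
  using assms(3,4)
proof (induction n arbitrary: a b)
  case 0
  then show ?case by auto
next
  case (Suc n)
  interpret G: pair_wf_digraph G by fact
  interpret H: pair_wf_digraph H by fact
  have rel: "R ^^ Suc n = R O R ^^ n" for R :: "'z rel"
    by (simp add: relpow_commute)
  \<comment> \<open>Staying or moving in each factor gives four combinations: the three kinds of
    product arcs and the identity.\<close>
  have step: "((a, b), (a', b')) \<in> (parcs (strong_product G H))\<^sup>=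
      \<longleftrightarrow> (a, a') \<in> (parcs G)\<^sup>= \<and> (b, b') \<in> (parcs H)\<^sup>=" for a' b'
    using Suc.prems by (auto simp: strong_product_def)
  have vG: "a' \<in> pverts G" if "(a, a') \<in> (parcs G)\<^sup>=" for a'
    using that Suc.prems G.in_arcsD2 by blast
  have vH: "b' \<in> pverts H" if "(b, b') \<in> (parcs H)\<^sup>=" for b'
    using that Suc.prems H.in_arcsD2 by blast
  have "((a, b), (c, d)) \<in> ((parcs (strong_product G H))\<^sup>=) ^^ Suc n
    \<longleftrightarrow> (\<exists>a' b'. ((a, b), (a', b')) \<in> (parcs (strong_product G H))\<^sup>= \<and>
           ((a', b'), (c, d)) \<in> ((parcs (strong_product G H))\<^sup>=) ^^ n)"
    unfolding rel by (auto simp only: relcomp_unfold mem_Collect_eq prod.case split_paired_Ex)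
  also have "\<dots> \<longleftrightarrow> (\<exists>a' b'. (a, a') \<in> (parcs G)\<^sup>= \<and> (b, b') \<in> (parcs H)\<^sup>= \<and>
           (a', c) \<in> ((parcs G)\<^sup>=) ^^ n \<and> (b', d) \<in> ((parcs H)\<^sup>=) ^^ n)"
    unfolding step using Suc.IH vG vH by blast
  also have "\<dots> \<longleftrightarrow> (a, c) \<in> ((parcs G)\<^sup>=) ^^ Suc n \<and> (b, d) \<in> ((parcs H)\<^sup>=) ^^ Suc n"
    unfolding rel by blast
  finally show ?case .
qed

text \<open>A maximum is at most \<open>n\<close> iff both entries are, and balls of the product are
  products of balls of the same radius.\<close>

lemma gdist_strong_product:
  assumes "pair_wf_digraph G" "pair_wf_digraph H" "a \<in> pverts G" "b \<in> pverts H"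
  shows "gdist (strong_product G H) (a, b) (c, d) = max (gdist G a c) (gdist H b d)"
proof (rule ereal_nat_eqI)
  have P: "pair_wf_digraph (strong_product G H)" "(a, b) \<in> pverts (strong_product G H)"
    using assms pair_wf_digraph_strong_product by (auto simp: strong_product_def)
  show "gdist (strong_product G H) (a, b) (c, d) = \<infinity> \<or>
      (\<exists>n::nat. gdist (strong_product G H) (a, b) (c, d) = ereal (real n))"
    by (rule gdist_nat_or_infinity[OF P(1)])
  show "max (gdist G a c) (gdist H b d) = \<infinity> \<or>
      (\<exists>n::nat. max (gdist G a c) (gdist H b d) = ereal (real n))"
    using gdist_nat_or_infinity[OF assms(1), of a c] gdist_nat_or_infinity[OF assms(2), of b d]
    by (metis max_def)
  show "gdist (strong_product G H) (a, b) (c, d) \<le> ereal (real n) \<longleftrightarrow>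
      max (gdist G a c) (gdist H b d) \<le> ereal (real n)" for n
    using relpow_strong_product[OF assms]
    by (simp add: gdist_le_iff_relpow[OF P] gdist_le_iff_relpow[OF assms(1,3)]
        gdist_le_iff_relpow[OF assms(2,4)])
qed

section \<open>Metric generators\<close>

lemma gdist_le_gdiameter:
  assumes "x \<in> pverts G" "y \<in> pverts G"
  shows "gdist G x y \<le> gdiameter G"
  unfolding gdiameter_def using assms by (intro SUP_upper2[of x] SUP_upper2[of y]) auto

text \<open>Each vertex resolves itself from all others, being the only one at distance 0 from
  itself. Hence the \<open>LEAST\<close> in \<open>metric_dim\<close> is attained.\<close>

lemma metric_generator_pverts:
  assumes "pair_wf_digraph G"
  shows "metric_generator G (pverts G)"
  unfolding metric_generator_def using gdist_eq_0_iff[OF assms] by (metis order_refl)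

text \<open>If \<open>S\<close> is empty, so is the product set. The disjunction confines this case
  to a one-vertex \<open>H\<close>, where no two vertices of the product differ in the second
  coordinate.\<close>

lemma metric_generator_strong_product:
  assumes H: "self_resolved k H" and G: "pair_graph G"
    and diameter_G: "gdiameter G < ereal (real k)"
    and S: "metric_generator G S" "S \<noteq> {} \<or> card (pverts H) = 1"
  shows "metric_generator (strong_product G H) (S \<times> pverts H)"
proof -
  interpret G: pair_graph G by fact
  interpret H: pair_graph H using H by (simp add: self_resolved_def)
  have wf: "pair_wf_digraph G" "pair_wf_digraph H" by unfold_locales
  have sym: "pair_sym_digraph H" by unfold_locales
  have SG: "S \<subseteq> pverts G" using S by (simp add: metric_generator_def)
  have dist: "gdist (strong_product G H) (s, w) (a, b) = max (gdist G s a) (gdist H w b)"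
    if "s \<in> S" "w \<in> pverts H" for s w a b
    using that SG gdist_strong_product[OF wf] by blast
  \<comment> \<open>Both entries of the maximum for \<open>(a, b)\<close> lie below
    \<open>gdist H w d\<close>: the first by the diameter bound, the second by the geodesic through
    \<open>b\<close>. The vertex \<open>c\<close> is arbitrary, since it can only enlarge the
    right-hand maximum.\<close>
  have resolved: "gdist (strong_product G H) (s, w) (a, b)
      < gdist (strong_product G H) (s, w) (c, d)"
    if "s \<in> S" "a \<in> pverts G" "w \<in> pverts H" "b \<noteq> d"
      "ereal (real k) \<le> gdist H d w" "b \<in> geodesic_interval H d w" for s w a b c d
  proof -
    have "gdist G s a < gdist H w d"
      using gdist_le_gdiameter[of s G a] diameter_G that SG gdist_commute[OF sym, of w d] by auto
    moreover have "gdist H w b < gdist H w d"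
      using gdist_less_if_in_interval[OF wf(2)] that gdist_commute[OF sym] by metis
    ultimately show ?thesis
      using that by (simp add: dist less_max_iff_disj)
  qed
  have "\<exists>u\<in>S \<times> pverts H. gdist (strong_product G H) u (a, b)
      \<noteq> gdist (strong_product G H) u (c, d)"
    if V: "a \<in> pverts G" "b \<in> pverts H" "c \<in> pverts G" "d \<in> pverts H" and ne: "(a, b) \<noteq> (c, d)"
    for a b c d
  proof (cases "b = d")
    case True
    then have "a \<noteq> c" using ne by simp
    then obtain s where s: "s \<in> S" "gdist G s a \<noteq> gdist G s c"
      using S(1) V unfolding metric_generator_def by meson
    \<comment> \<open>Seen from \<open>(s, b)\<close>, the layer over \<open>b\<close> is an
      isometric copy of \<open>G\<close>.\<close>
    have "max (gdist G s e) (gdist H b b) = gdist G s e" for e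
      using gdist_eq_0_iff[OF wf(2) V(2), of b] gdist_nat_or_infinity[OF wf(1), of s e]
      by (auto simp: max_def)
    then show ?thesis
      using s True V by (intro bexI[of _ "(s, b)"]) (auto simp: dist)
  next
    case False
    then have "card (pverts H) \<noteq> 1" using V by (auto simp: card_1_singleton_iff)
    then obtain s where s: "s \<in> S" using S(2) by blast
    obtain w where w: "w \<in> pverts H" and
      "(ereal (real k) \<le> gdist H d w \<and> b \<in> geodesic_interval H d w) \<or>
       (ereal (real k) \<le> gdist H b w \<and> d \<in> geodesic_interval H b w)"
      using H V False unfolding self_resolved_def by meson
    then have "gdist (strong_product G H) (s, w) (a, b) \<noteq> gdist (strong_product G H) (s, w) (c, d)"
      \<comment> \<open>The two instances exchange the roles of the two vertices, matching the two
        alternatives for \<open>w\<close>.\<close>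
      using resolved[OF s V(1) w False, of c] resolved[OF s V(3) w, of d b a] False by auto
    then show ?thesis using s w by blast
  qed
  then show ?thesis
    using SG by (auto simp: metric_generator_def strong_product_def)
qed

(* nondegenerate: if G = K_1 then dim G = 0 while the strong product is a copy of H, so the
   inequality fails for every H with at least two vertices; exactly these pairs are excluded. *)
theorem theorem2:
  fixes G :: "'a pair_pre_digraph" and H :: "'b pair_pre_digraph" and k n\<^sub>2 :: nat
  assumes H: "self_resolved k H"
    and order_H: "card (pverts H) = n\<^sub>2"
    and G: "pair_graph G" "Digraph_Component.connected (with_proj G)"
    and diameter_G: "gdiameter G < ereal (real k)"
    and nondegenerate: "card (pverts G) \<ge> 2 \<or> card (pverts H) = 1"
  shows "metric_dim (strong_product G H) \<le> n\<^sub>2 * metric_dim G"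
proof -
  interpret G: pair_graph G by (rule G(1))
  have wf: "pair_wf_digraph G" by unfold_locales
  have "\<exists>S. metric_generator G S \<and> card S = metric_dim G"
    unfolding metric_dim_def
    by (rule LeastI_ex) (use metric_generator_pverts[OF wf] in blast)
  then obtain S where S: "metric_generator G S" "card S = metric_dim G" by blast
  \<comment> \<open>The empty set separates no two vertices, so it generates only graphs with at
    most one vertex.\<close>
  have "S \<noteq> {}" if "card (pverts G) \<ge> 2"
  proof
    assume "S = {}"
    then have "x = y" if "x \<in> pverts G" "y \<in> pverts G" for x y
      using S(1) that by (auto simp: metric_generator_def)
    then have "card (pverts G) \<le> 1"
      using G.pair_finite_verts by (simp add: card_le_Suc0_iff_eq)
    with that show False by simp
  qed
  then have "metric_generator (strong_product G H) (S \<times> pverts H)"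
    using metric_generator_strong_product[OF H G(1) diameter_G S(1)] nondegenerate by blast
  then have "metric_dim (strong_product G H) \<le> card (S \<times> pverts H)"
    unfolding metric_dim_def by (intro Least_le) blast
  then show ?thesis
    using S(2) order_H by (simp add: card_cartesian_product mult.commute)
qed

end
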